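(* Let $T\ge 1$ be an integer, let $\sigma_\theta>0$, and let $p(\theta_{1:T})$ be the density on $\mathbb{R}^T$ of a (discrete-time) Wiener process with standard deviation $\sigma_\theta$, i.e. with the convention $\theta_0=0$, $\theta_t\mid\theta_{t-1}\sim\mathcal N(\theta_{t-1},\sigma_\theta^2)$ (variance $\sigma_\theta^2$) for $t=1,\dots,T$. Let $\mu_1,\dots,\mu_T$ be real numbers and $\sigma_1,\dots,\sigma_T$ be positive real numbers, and let $q(\theta_{1:T})$ be the probability distribution on $\mathbb{R}^T$ with density $$q(\theta_{1:T})\;\propto\; p(\theta_{1:T})\prod_{t=1}^T\exp\left\{-\frac12\left(\frac{\theta_t-\mu_t}{\sigma_t}\right)^2\right\}.$$ Put $\lambda_\theta=1/\sigma_\theta^2$ and $\lambda_t=1/\sigma_t^2$, and define $\rho_t,\tau_t$ by the backward recursion $\rho_{T+1}=0$, $\tau_{T+1}=0$, and for $t=T,T-1,\dots,1$, $$\rho_t=\frac{\lambda_t+\rho_{t+1}\lambda_\theta}{\lambda_\theta+\lambda_t+\rho_{t+1}\lambda_\theta},\qquad \tau_t=\frac{\lambda_t\mu_t+(\rho_{t+1}\lambda_\theta)\tau_{t+1}}{\lambda_t+\rho_{t+1}\lambda_\theta}.$$ Then $q(\theta_{1:T})$ is a Linear Gaussian Model: under $q$ (with $\theta_0=0$), for every $t=1,\dots,T$, the conditional distribution of $\theta_t$ given $\theta_1,\dots,\theta_{t-1}$ depends only on $\theta_{t-1}$ and is the Gaussian distribution with mean $$\widetilde\mu_t=\frac{\lambda_\theta\theta_{t-1}+\lambda_t\mu_t+(\rho_{t+1}\lambda_\theta)\tau_{t+1}}{\lambda_\theta+\lambda_t+\rho_{t+1}\lambda_\theta}$$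 and standard deviation $$\widetilde\sigma_t=\sigma_\theta\sqrt{1-\rho_t}.$$
   Context: Notation: $\theta_{1:T}=(\theta_1,\dots,\theta_T)\in\mathbb{R}^T$. A (discrete-time) Wiener process with standard deviation $\sigma_\theta$ is a Gaussian random walk: with $\theta_0=0$, the increments $\theta_t-\theta_{t-1}$, $t=1,\dots,T$, are independent Gaussians with mean $0$ and variance $\sigma_\theta^2$; thus $p(\theta_{1:T})\propto\prod_{t=1}^T\exp\{-(\theta_t-\theta_{t-1})^2/(2\sigma_\theta^2)\}$. A Linear Gaussian Model is a Markov process $(\theta_t)_{t=1}^T$ of real random variables (with $\theta_0=0$) such that $\theta_t$ given $\theta_{t-1}$ is Gaussian with mean $\alpha_t\theta_{t-1}+\beta_t$ and standard deviation $s_t$, for real constants $\alpha_t,\beta_t$ and $s_t>0$. The symbol $\propto$ means equality up to a positive normalizing constant not depending on $\theta_{1:T}$, chosen so that $q$ integrates to $1$. *)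

theory Defs
  imports "HOL-Probability.Probability"
begin

definition normal_measure :: "real \<Rightarrow> real \<Rightarrow> real measure" where
  "normal_measure m s = density lborel (\<lambda>x. ennreal (normal_density m s x))"

text \<open>Meant for nonnegative integrable \<open>f\<close> with positive integral, for which it is a probability
  measure; otherwise the quotient takes junk values.\<close>

definition normalized_density :: "'a measure \<Rightarrow> ('a \<Rightarrow> real) \<Rightarrow> 'a measure" where
  "normalized_density N f = density N (\<lambda>x. ennreal (f x / (\<integral>y. f y \<partial>N)))"

text \<open>Points of \<open>T\<close>-dimensional space are extensional functions on \<open>{1..T}\<close>.
  The coordinate process is extended by the convention that it starts at 0 at time 0.\<close>

definition lborel_space :: "nat \<Rightarrow> (nat \<Rightarrow> real) measure" where
  "lborel_space T = (\<Pi>\<^sub>M t\<in>{1..T}. lborel)"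

definition coord :: "nat \<Rightarrow> (nat \<Rightarrow> real) \<Rightarrow> real" where
  "coord t \<theta> = (if t = 0 then 0 else \<theta> t)"

definition wiener_process :: "'a measure \<Rightarrow> (nat \<Rightarrow> 'a \<Rightarrow> real) \<Rightarrow> nat \<Rightarrow> real \<Rightarrow> bool" where
  "wiener_process M X T s \<longleftrightarrow>
     prob_space M \<and>
     (\<forall>\<omega>\<in>space M. X 0 \<omega> = 0) \<and>
     prob_space.indep_vars M (\<lambda>_. borel) (\<lambda>t \<omega>. X t \<omega> - X (t - 1) \<omega>) {1..T} \<and>
     (\<forall>t\<in>{1..T}. distributed M lborel (\<lambda>\<omega>. X t \<omega> - X (t - 1) \<omega>)
                    (\<lambda>x. ennreal (normal_density 0 s x)))"

text \<open>The \<open>\<sigma>\<close>-algebras generated by \<open>X 1, \<dots>, X (t - 1)\<close> and by the single variable \<open>X t\<close>.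
  The former is trivial for \<open>t = 1\<close>.\<close>

definition past_algebra :: "'a measure \<Rightarrow> (nat \<Rightarrow> 'a \<Rightarrow> real) \<Rightarrow> nat \<Rightarrow> 'a measure" where
  "past_algebra M X t =
     vimage_algebra (space M) (\<lambda>\<omega>. \<lambda>i\<in>{1..<t}. X i \<omega>) (\<Pi>\<^sub>M i\<in>{1..<t}. borel)"

definition present_algebra :: "'a measure \<Rightarrow> (nat \<Rightarrow> 'a \<Rightarrow> real) \<Rightarrow> nat \<Rightarrow> 'a measure" where
  "present_algebra M X t = vimage_algebra (space M) (X t) borel"

text \<open>\<open>K\<close> is a regular conditional distribution of \<open>Y\<close> given the sub-\<open>\<sigma>\<close>-algebra \<open>F\<close>.\<close>

definition has_cond_distr ::
    "'a measure \<Rightarrow> 'a measure \<Rightarrow> ('a \<Rightarrow> real) \<Rightarrow> ('a \<Rightarrow> real measure) \<Rightarrow> bool" where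
  "has_cond_distr M F Y K \<longleftrightarrow>
     subalgebra M F \<and>
     Y \<in> borel_measurable M \<and>
     K \<in> F \<rightarrow>\<^sub>M prob_algebra borel \<and>
     (\<forall>A\<in>sets borel. AE \<omega> in M.
        real_cond_exp M F (\<lambda>\<omega>. indicator A (Y \<omega>)) \<omega> = measure (K \<omega>) A)"

definition markov_process :: "'a measure \<Rightarrow> (nat \<Rightarrow> 'a \<Rightarrow> real) \<Rightarrow> nat \<Rightarrow> bool" where
  "markov_process M X T \<longleftrightarrow>
     prob_space M \<and>
     (\<forall>t\<in>{0..T}. X t \<in> borel_measurable M) \<and>
     (\<forall>t\<in>{1..T}. \<forall>A\<in>sets borel. AE \<omega> in M.
        real_cond_exp M (past_algebra M X t) (\<lambda>\<omega>. indicator A (X t \<omega>)) \<omega> =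
        real_cond_exp M (present_algebra M X (t - 1)) (\<lambda>\<omega>. indicator A (X t \<omega>)) \<omega>)"

definition linear_gaussian_model :: "'a measure \<Rightarrow> (nat \<Rightarrow> 'a \<Rightarrow> real) \<Rightarrow> nat \<Rightarrow> bool" where
  "linear_gaussian_model M X T \<longleftrightarrow>
     markov_process M X T \<and>
     (\<forall>\<omega>\<in>space M. X 0 \<omega> = 0) \<and>
     (\<exists>\<alpha> \<beta> s. \<forall>t\<in>{1..T}. s t > 0 \<and>
        has_cond_distr M (present_algebra M X (t - 1)) (X t)
          (\<lambda>\<omega>. normal_measure (\<alpha> t * X (t - 1) \<omega> + \<beta> t) (s t)))"

end

theory Submission
  imports Defs
begin

text \<open>
  The increments of a Wiener process are independent Gaussians, so its law is the image of a product
  measure under the partial sum map; hence \<open>p\<close> agrees almost everywhere with the product of the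
  transition densities. Multiply by the Gaussian weights and integrate out \<open>\<theta>\<^sub>T, \<theta>\<^sub>T\<^sub>-\<^sub>1, \<dots>\<close>: completing
  the square at time \<open>t\<close> splits off the claimed Gaussian transition density in \<open>\<theta>\<^sub>t\<close> and leaves the
  message \<open>exp (- \<rho>\<^sub>t \<lambda>\<^sub>\<theta> (\<theta>\<^sub>t\<^sub>-\<^sub>1 - \<tau>\<^sub>t)\<^sup>2 / 2)\<close>, up to a constant. The messages telescope, so the density
  of \<open>q\<close> is proportional to a product of transition densities. Such a product already integrates to 1,
  and its factors are the conditional densities.
\<close>

text \<open>Keeps \<open>1\<close> in \<open>{1..n}\<close> and in \<open>t - 1\<close> from being
  rewritten to \<open>Suc 0\<close>, so that facts stated with \<open>1\<close> go on
  matching.\<close>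

declare One_nat_def [simp del]

subsection \<open>Lebesgue measure on finitely many coordinates\<close>

lemma space_lborel_space: "space (lborel_space n) = {1..n} \<rightarrow>\<^sub>E UNIV"
  by (simp add: lborel_space_def space_PiM)

lemma sets_lborel_space [measurable_cong]: "sets (lborel_space n) = sets (\<Pi>\<^sub>M t\<in>{1..n}. borel)"
  unfolding lborel_space_def by (intro sets_PiM_cong) auto

interpretation lborel_product: product_sigma_finite "\<lambda>_::nat. lborel :: real measure"
  by standard

lemma sigma_finite_lborel_space: "sigma_finite_measure (lborel_space n)"
proof -
  interpret finite_product_sigma_finite "\<lambda>_::nat. lborel :: real measure" "{1..n}"
    by standard auto
  show ?thesis unfolding lborel_space_def by (rule sigma_finite_measure_axioms)
qed

lemma measurable_coord:
  assumes "{1..n} \<subseteq> I" "t \<le> n"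
  shows "coord t \<in> borel_measurable (\<Pi>\<^sub>M i\<in>I. borel)"
proof (cases "t = 0")
  case False
  then have "t \<in> I" using assms by auto
  then show ?thesis using False by (simp add: coord_def[abs_def])
qed (simp add: coord_def[abs_def])

lemma measurable_coord_lborel_space:
  "t \<le> n \<Longrightarrow> coord t \<in> borel_measurable (lborel_space n)"
  by (subst measurable_cong_sets[OF sets_lborel_space refl]) (auto intro: measurable_coord)

lemma measurable_component_singleton_lborel_space:
  "t \<in> {1..n} \<Longrightarrow> (\<lambda>x. x t) \<in> borel_measurable (lborel_space n)"
  by (subst measurable_cong_sets[OF sets_lborel_space refl]) auto

lemma measurable_extend_lborel_space:
  "(\<lambda>(x, y). x(Suc n := y)) \<in> lborel_space n \<Otimes>\<^sub>M borel \<rightarrow>\<^sub>M lborel_space (Suc n)"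
proof -
  have "insert (Suc n) {1..n} = {1..Suc n}" by auto
  then have "(\<lambda>(x, y). x(Suc n := y)) \<in> (\<Pi>\<^sub>M i\<in>{1..n}. borel) \<Otimes>\<^sub>M borel \<rightarrow>\<^sub>M (\<Pi>\<^sub>M i\<in>{1..Suc n}. borel)"
    using measurable_add_dim[of "Suc n" "{1..n}" "\<lambda>_. borel"] by simp
  then show ?thesis
    by (subst measurable_cong_sets[OF sets_pair_measure_cong[OF sets_lborel_space refl] sets_lborel_space])
qed

lemma nn_integral_lborel_space_Suc:
  assumes "h \<in> borel_measurable (lborel_space (Suc n))"
  shows "(\<integral>\<^sup>+x. h x \<partial>lborel_space (Suc n)) = (\<integral>\<^sup>+x. (\<integral>\<^sup>+y. h (x(Suc n := y)) \<partial>lborel) \<partial>lborel_space n)"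
proof -
  have "insert (Suc n) {1..n} = {1..Suc n}" by auto
  then show ?thesis
    using assms lborel_product.product_nn_integral_insert[of "{1..n}" "Suc n" h]
    by (simp add: lborel_space_def)
qed

lemma coord_upd: "t \<le> n \<Longrightarrow> coord t (x(Suc n := y)) = coord t x"
  by (simp add: coord_def)

subsection \<open>Chains with transition densities\<close>

text \<open>Two instances occur: the random walk behind \<open>p\<close> and the Gaussian
  transitions of the posterior. Values in \<open>ennreal\<close> let Tonelli apply without
  integrability conditions.\<close>

locale transition_densities =
  fixes k :: "nat \<Rightarrow> real \<Rightarrow> real \<Rightarrow> ennreal"
  assumes measurable_k: "\<And>t. (\<lambda>(y, z). k t y z) \<in> borel_measurable (borel \<Otimes>\<^sub>M borel)"
    and nn_integral_k: "\<And>t y. (\<integral>\<^sup>+z. k t y z \<partial>lborel) = 1"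
begin

lemma measurable_k' [measurable (raw)]:
  assumes "f \<in> borel_measurable M" "g \<in> borel_measurable M"
  shows "(\<lambda>x. k t (f x) (g x)) \<in> borel_measurable M"
  using measurable_compose[OF measurable_Pair[OF assms] measurable_k[of t]] by simp

definition kernel :: "nat \<Rightarrow> real \<Rightarrow> real measure" where
  "kernel t y = density lborel (k t y)"

lemma prob_space_kernel: "prob_space (kernel t y)"
  by (rule prob_spaceI) (simp add: kernel_def emeasure_density nn_integral_k)

lemma measurable_kernel: "kernel t \<in> borel \<rightarrow>\<^sub>M prob_algebra borel"
proof (rule measurable_prob_algebraI)
  show "kernel t \<in> borel \<rightarrow>\<^sub>M subprob_algebra borel"
  proof (rule measurable_subprob_algebra)
    fix A :: "real set" assume [measurable]: "A \<in> sets borel"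
    have "(\<lambda>y. \<integral>\<^sup>+z. k t y z * indicator A z \<partial>lborel) \<in> borel_measurable borel"
      by measurable
    then show "(\<lambda>y. emeasure (kernel t y) A) \<in> borel_measurable borel"
      by (simp add: kernel_def emeasure_density)
  qed (auto simp: kernel_def intro!: prob_space_imp_subprob_space prob_space_kernel[unfolded kernel_def])
qed (rule prob_space_kernel)

text \<open>The factor for \<open>t = 1\<close> is \<open>k 1 0 (x 1)\<close>, because
  \<open>coord 0\<close> is constantly 0: the chain starts at 0.\<close>

definition chain_density :: "nat \<Rightarrow> (nat \<Rightarrow> real) \<Rightarrow> ennreal" where
  "chain_density n x = (\<Prod>t=1..n. k t (coord (t - 1) x) (x t))"

definition chain :: "nat \<Rightarrow> (nat \<Rightarrow> real) measure" where
  "chain n = density (lborel_space n) (chain_density n)"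

lemma measurable_chain_density [measurable]:
  "chain_density n \<in> borel_measurable (lborel_space n)"
  unfolding chain_density_def[abs_def]
proof (intro borel_measurable_prod_ennreal measurable_k')
  fix t assume t: "t \<in> {1..n}"
  show "coord (t - 1) \<in> borel_measurable (lborel_space n)"
    using t by (intro measurable_coord_lborel_space) auto
  show "(\<lambda>x. x t) \<in> borel_measurable (lborel_space n)"
    using t by measurable
qed

lemma sets_chain [measurable_cong]: "sets (chain n) = sets (lborel_space n)"
  and space_chain: "space (chain n) = space (lborel_space n)"
  by (simp_all add: chain_def)

lemma chain_density_Suc:
  "chain_density (Suc n) (x(Suc n := y)) = chain_density n x * k (Suc n) (coord n x) y"
proof -
  have "(\<Prod>t=1..n. k t (coord (t - 1) (x(Suc n := y))) ((x(Suc n := y)) t))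
    = (\<Prod>t=1..n. k t (coord (t - 1) x) (x t))"
    by (intro prod.cong) (auto simp: coord_upd coord_def)
  then show ?thesis by (simp add: chain_density_def coord_upd)
qed

text \<open>Tonelli in the last coordinate: only the last factor of the density involves it, and the
  other factors form the density of \<open>chain n\<close>.\<close>

lemma nn_integral_chain_Suc:
  assumes [measurable]: "h \<in> borel_measurable (lborel_space (Suc n))"
  shows "(\<integral>\<^sup>+x. h x \<partial>chain (Suc n))
    = (\<integral>\<^sup>+x. (\<integral>\<^sup>+y. k (Suc n) (coord n x) y * h (x(Suc n := y)) \<partial>lborel) \<partial>chain n)"
proof -
  note [measurable] = measurable_extend_lborel_space[of n] measurable_coord_lborel_space[of n n]
  have up [measurable]: "(\<lambda>y. x(Suc n := y)) \<in> borel \<rightarrow>\<^sub>M lborel_space (Suc n)"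
    if "x \<in> space (lborel_space n)" for x
    using measurable_compose[OF measurable_Pair1'[OF that] measurable_extend_lborel_space] by simp
  have "(\<integral>\<^sup>+x. h x \<partial>chain (Suc n)) = (\<integral>\<^sup>+x. chain_density (Suc n) x * h x \<partial>lborel_space (Suc n))"
    by (simp add: chain_def nn_integral_density)
  also have "\<dots> = (\<integral>\<^sup>+x. (\<integral>\<^sup>+y. chain_density (Suc n) (x(Suc n := y)) * h (x(Suc n := y)) \<partial>lborel) \<partial>lborel_space n)"
    by (rule nn_integral_lborel_space_Suc) measurable
  also have "\<dots> = (\<integral>\<^sup>+x. chain_density n x * (\<integral>\<^sup>+y. k (Suc n) (coord n x) y * h (x(Suc n := y)) \<partial>lborel) \<partial>lborel_space n)"
    by (intro nn_integral_cong) (simp add: chain_density_Suc mult.assoc nn_integral_cmult)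
  also have "\<dots> = (\<integral>\<^sup>+x. (\<integral>\<^sup>+y. k (Suc n) (coord n x) y * h (x(Suc n := y)) \<partial>lborel) \<partial>chain n)"
    unfolding chain_def by (subst nn_integral_density) auto
  finally show ?thesis .
qed

text \<open>Each transition density integrates to 1 whatever the previous value is, so the
  coordinates after \<open>t\<close> can be integrated out one at a time, the last one
  first.\<close>

lemma nn_integral_chain_restrict:
  assumes "t \<le> n" and h: "h \<in> borel_measurable (lborel_space t)"
  shows "(\<integral>\<^sup>+x. h (restrict x {1..t}) \<partial>chain n) = (\<integral>\<^sup>+x. h x \<partial>chain t)"
  using \<open>t \<le> n\<close>
proof (induction n rule: dec_induct)
  case base
  show ?case
    by (intro nn_integral_cong) (simp add: space_chain space_lborel_space PiE_restrict)
next
  case (step n)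
  have "(\<lambda>x. restrict x {1..t}) \<in> (\<Pi>\<^sub>M i\<in>{1..Suc n}. borel) \<rightarrow>\<^sub>M (\<Pi>\<^sub>M i\<in>{1..t}. borel)"
    using step by (intro measurable_restrict_subset) auto
  then have r: "(\<lambda>x. restrict x {1..t}) \<in> lborel_space (Suc n) \<rightarrow>\<^sub>M lborel_space t"
    by (subst measurable_cong_sets[OF sets_lborel_space sets_lborel_space])
  have upd: "restrict (x(Suc n := y)) {1..t} = restrict x {1..t}" for x :: "nat \<Rightarrow> real" and y
    using step by (auto simp: restrict_def fun_eq_iff)
  have "(\<integral>\<^sup>+x. h (restrict x {1..t}) \<partial>chain (Suc n))
      = (\<integral>\<^sup>+x. (\<integral>\<^sup>+y. k (Suc n) (coord n x) y * h (restrict x {1..t}) \<partial>lborel) \<partial>chain n)"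
    by (subst nn_integral_chain_Suc[OF measurable_compose[OF r h]]) (simp add: upd)
  also have "\<dots> = (\<integral>\<^sup>+x. h (restrict x {1..t}) \<partial>chain n)"
    by (intro nn_integral_cong) (simp add: nn_integral_multc nn_integral_k)
  finally show ?case by (simp only: step.IH)
qed

text \<open>The total mass is that of the marginal at time 0, where the space is a single point of
  mass 1 and the density is an empty product.\<close>

lemma prob_space_chain: "prob_space (chain n)"
proof (rule prob_spaceI)
  have "emeasure (chain n) (space (chain n)) = (\<integral>\<^sup>+x. 1 \<partial>chain n)" by simp
  also have "\<dots> = (\<integral>\<^sup>+x. 1 \<partial>chain 0)"
    using nn_integral_chain_restrict[of 0 n "\<lambda>_. 1"] by simp
  also have "\<dots> = 1"
    by (simp add: chain_def chain_density_def[abs_def] lborel_space_def emeasure_density PiM_empty)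
  finally show "emeasure (chain n) (space (chain n)) = 1" .
qed

lemma coord_restrict: "t \<le> n \<Longrightarrow> coord t (restrict x {1..n}) = coord t x"
  by (auto simp: coord_def)

text \<open>With \<open>u\<close> and \<open>v\<close> indicators, this is the integral identity
  that characterizes conditional probability given the past. In the marginal up to \<open>t\<close>
  the coordinate \<open>t\<close> is the last one and can be integrated out.\<close>

lemma nn_integral_chain_transition:
  assumes "t \<in> {1..n}"
    and u: "u \<in> borel_measurable (\<Pi>\<^sub>M i\<in>{1..<t}. borel)"
    and v [measurable]: "v \<in> borel_measurable borel"
  shows "(\<integral>\<^sup>+x. u (restrict x {1..<t}) * v (x t) \<partial>chain n)
    = (\<integral>\<^sup>+x. u (restrict x {1..<t}) * (\<integral>\<^sup>+y. v y \<partial>kernel t (coord (t - 1) x)) \<partial>chain n)"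
proof -
  obtain m where m: "t = Suc m" "m < n" using assms(1) by (cases t) auto
  have Im: "{1..<t} = {1..m}" using m by auto
  have u' [measurable]: "u \<in> borel_measurable (lborel_space m)"
    using u by (subst measurable_cong_sets[OF sets_lborel_space refl]) (simp add: Im[symmetric])
  have "(\<lambda>x. restrict x {1..m}) \<in> (\<Pi>\<^sub>M i\<in>{1..t}. borel) \<rightarrow>\<^sub>M (\<Pi>\<^sub>M i\<in>{1..m}. borel)"
    using m by (intro measurable_restrict_subset) auto
  then have r [measurable]: "(\<lambda>x. restrict x {1..m}) \<in> lborel_space t \<rightarrow>\<^sub>M lborel_space m"
    by (subst measurable_cong_sets[OF sets_lborel_space sets_lborel_space])
  have c [measurable]: "coord m \<in> borel_measurable (lborel_space t)"
    using m by (intro measurable_coord_lborel_space) auto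
  have xt [measurable]: "(\<lambda>x. x t) \<in> borel_measurable (lborel_space t)"
    using m by (intro measurable_component_singleton_lborel_space) auto
  have uv: "(\<lambda>x. u (restrict x {1..m}) * v (x t)) \<in> borel_measurable (lborel_space t)"
    by measurable
  have tn: "t \<le> n" and tt: "t \<in> {1..t}" using assms(1) by auto
  have tm: "t - 1 = m" using m by simp
  have mt: "min t m = m" using m by simp
  have upd: "restrict (x(t := y)) {1..m} = restrict x {1..m}" for x :: "nat \<Rightarrow> real" and y
    using m by (auto simp: restrict_def fun_eq_iff)
  define w where "w = (\<lambda>c. \<integral>\<^sup>+y. v y \<partial>kernel t c)"
  have w_eq: "w c = (\<integral>\<^sup>+y. k t c y * v y \<partial>lborel)" for c
    unfolding w_def kernel_def by (subst nn_integral_density) auto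
  have w [measurable]: "w \<in> borel_measurable borel"
    unfolding w_eq[abs_def] by measurable
  have pull: "(\<integral>\<^sup>+y. k t c y * (a * v y) \<partial>lborel) = a * w c" for a c
    by (simp add: w_eq mult.left_commute[of _ a] nn_integral_cmult)
  have uw: "(\<lambda>x. u (restrict x {1..m}) * w (coord m x)) \<in> borel_measurable (lborel_space t)"
    by measurable
  have "(\<integral>\<^sup>+x. u (restrict x {1..m}) * v (x t) \<partial>chain n)
    = (\<integral>\<^sup>+x. u (restrict x {1..m}) * v (x t) \<partial>chain t)"
    using nn_integral_chain_restrict[OF tn uv] tt by (simp add: mt)
  also have "\<dots> = (\<integral>\<^sup>+x. u (restrict x {1..m}) * w (coord m x) \<partial>chain m)"
    using nn_integral_chain_Suc[OF uv[unfolded m(1)], folded m(1)]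
    by (simp add: upd pull cong: nn_integral_cong)
  \<comment> \<open>The integrand no longer involves coordinate \<open>t\<close>, so putting that
    coordinate back only multiplies by the integral of a transition density, which is 1.\<close>
  also have "\<dots> = (\<integral>\<^sup>+x. u (restrict x {1..m}) * w (coord m x) \<partial>chain t)"
    using nn_integral_chain_Suc[OF uw[unfolded m(1)], folded m(1)]
    by (simp add: upd coord_upd[of m m, folded m(1)] nn_integral_multc nn_integral_k cong: nn_integral_cong)
  also have "\<dots> = (\<integral>\<^sup>+x. u (restrict x {1..m}) * w (coord m x) \<partial>chain n)"
    using nn_integral_chain_restrict[OF tn uw] m(1)
    by (simp add: mt coord_restrict)
  finally show ?thesis by (simp only: Im tm w_def)
qed

section \<open>Conditional distributions of a chain\<close>

lemma restrict_coord: "restrict (\<lambda>i. coord i x) {1..<t} = restrict x {1..<t}"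
  by (auto simp: restrict_def coord_def fun_eq_iff)

lemma sets_past_algebra_chain:
  "sets (past_algebra (chain n) coord t)
    = {(\<lambda>x. restrict x {1..<t}) -` C \<inter> space (chain n) | C. C \<in> sets (\<Pi>\<^sub>M i\<in>{1..<t}. borel)}"
  unfolding past_algebra_def restrict_coord
  by (subst sets_vimage_algebra2) (auto simp: space_PiM)

lemma subalgebra_past:
  assumes "t \<le> n + 1"
  shows "subalgebra (chain n) (past_algebra (chain n) coord t)"
proof -
  have "(\<lambda>x. restrict x {1..<t}) \<in> (\<Pi>\<^sub>M i\<in>{1..n}. borel) \<rightarrow>\<^sub>M (\<Pi>\<^sub>M i\<in>{1..<t}. borel)"
    using assms by (intro measurable_restrict_subset) auto
  then have "(\<lambda>x. restrict x {1..<t}) \<in> chain n \<rightarrow>\<^sub>M (\<Pi>\<^sub>M i\<in>{1..<t}. borel)"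
    by (simp add: measurable_cong_sets[OF trans[OF sets_chain sets_lborel_space] refl])
  then show ?thesis
    unfolding subalgebra_def sets_past_algebra_chain
    by (auto simp: past_algebra_def dest: measurable_sets)
qed

lemma measurable_coord_past:
  assumes "t \<in> {1..n}"
  shows "coord (t - 1) \<in> borel_measurable (past_algebra (chain n) coord t)"
proof -
  have 1: "(\<lambda>x. restrict x {1..<t}) \<in> past_algebra (chain n) coord t \<rightarrow>\<^sub>M (\<Pi>\<^sub>M i\<in>{1..<t}. borel)"
    unfolding past_algebra_def restrict_coord
    by (intro measurable_vimage_algebra1) (auto simp: space_PiM)
  have 2: "coord (t - 1) \<in> borel_measurable (\<Pi>\<^sub>M i\<in>{1..<t}. borel)"
    using assms by (intro measurable_coord[of "t - 1"]) auto
  have "coord (t - 1) (restrict x {1..<t}) = coord (t - 1) x" for x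
    using assms by (auto simp: coord_def)
  then show ?thesis using measurable_compose[OF 1 2] by simp
qed

lemma subalgebra_present:
  assumes "t \<in> {1..n}"
  shows "subalgebra (past_algebra (chain n) coord t) (present_algebra (chain n) coord (t - 1))"
proof -
  have "sets (present_algebra (chain n) coord (t - 1))
    = {coord (t - 1) -` A \<inter> space (past_algebra (chain n) coord t) | A. A \<in> sets borel}"
    unfolding present_algebra_def by (subst sets_vimage_algebra2) (auto simp: past_algebra_def)
  then show ?thesis
    unfolding subalgebra_def using measurable_sets[OF measurable_coord_past[OF assms]]
    by (auto simp: past_algebra_def present_algebra_def)
qed

text \<open>The conditions place \<open>F\<close> between the sigma-algebra of the preceding value
  and that of the whole past, so one argument serves both. The kernel is measurable already for the
  smaller one, and the integral identity holds on all events of the larger one.\<close>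

lemma has_cond_distr_chain:
  assumes t: "t \<in> {1..n}"
    and F: "subalgebra (past_algebra (chain n) coord t) F"
    and c: "coord (t - 1) \<in> borel_measurable F"
  shows "has_cond_distr (chain n) F (coord t) (\<lambda>x. kernel t (coord (t - 1) x))"
  unfolding has_cond_distr_def
proof (intro conjI ballI)
  have "subalgebra (chain n) (past_algebra (chain n) coord t)"
    using t by (intro subalgebra_past) auto
  then show sub: "subalgebra (chain n) F"
    using F by (auto simp: subalgebra_def)
  have "coord t \<in> borel_measurable (lborel_space n)"
    using t by (intro measurable_coord_lborel_space) auto
  then show ct [measurable]: "coord t \<in> borel_measurable (chain n)"
    by (simp add: measurable_cong_sets[OF sets_chain refl])
  show K: "(\<lambda>x. kernel t (coord (t - 1) x)) \<in> F \<rightarrow>\<^sub>M prob_algebra borel"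
    by (rule measurable_compose[OF c measurable_kernel])
  fix A :: "real set" assume A [measurable]: "A \<in> sets borel"
  interpret prob_space "chain n" by (rule prob_space_chain)
  interpret finite_measure_subalgebra "chain n" F by standard (rule sub)
  have mF [measurable]: "(\<lambda>x. measure (kernel t (coord (t - 1) x)) A) \<in> borel_measurable F"
    using measurable_compose[OF measurable_prob_algebraD[OF K] measurable_measure_subprob_algebra[OF A]] .
  have m [measurable]: "(\<lambda>x. measure (kernel t (coord (t - 1) x)) A) \<in> borel_measurable (chain n)"
    by (rule measurable_from_subalg[OF sub mF])
  have le1: "measure (kernel t y) A \<le> 1" for y
    by (rule prob_space.prob_le_1[OF prob_space_kernel])
  show "AE x in chain n. real_cond_exp (chain n) F (\<lambda>x. indicator A (coord t x)) x
      = measure (kernel t (coord (t - 1) x)) A"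
  proof (rule real_cond_exp_charact)
    fix B assume B: "B \<in> sets F"
    then have Bp: "B \<in> sets (past_algebra (chain n) coord t)"
      using F by (auto simp: subalgebra_def)
    have [measurable]: "B \<in> sets (chain n)"
      using B sub by (auto simp: subalgebra_def)
    \<comment> \<open>An event of the past is a cylinder, so its indicator has the form
      \<open>u (restrict x {1..<t})\<close> to which \<open>nn_integral_chain_transition\<close>
      applies.\<close>
    obtain C where C: "C \<in> sets (\<Pi>\<^sub>M i\<in>{1..<t}. borel)"
      and B_eq: "B = (\<lambda>x. restrict x {1..<t}) -` C \<inter> space (chain n)"
      using Bp unfolding sets_past_algebra_chain by auto
    have inB: "x \<in> B \<longleftrightarrow> restrict x {1..<t} \<in> C" if "x \<in> space (chain n)" for x
      using that by (simp add: B_eq)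
    have iB: "indicator B x = indicator C (restrict x {1..<t})" if "x \<in> space (chain n)" for x
      using inB[OF that] by (simp add: indicator_def)
    have "(\<integral>x\<in>B. indicator A (coord t x) \<partial>chain n)
        = enn2real (\<integral>\<^sup>+x. ennreal (indicator B x * indicator A (coord t x)) \<partial>chain n)"
      unfolding set_lebesgue_integral_def real_scaleR_def
      by (rule integral_eq_nn_integral) auto
    also have "(\<integral>\<^sup>+x. ennreal (indicator B x * indicator A (coord t x)) \<partial>chain n)
        = (\<integral>\<^sup>+x. indicator C (restrict x {1..<t}) * indicator A (x t) \<partial>chain n)"
      using t by (intro nn_integral_cong)
        (auto simp: inB coord_def indicator_def split: if_splits)
    also have "\<dots> = (\<integral>\<^sup>+x. indicator C (restrict x {1..<t})
        * (\<integral>\<^sup>+y. indicator A y \<partial>kernel t (coord (t - 1) x)) \<partial>chain n)"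
      using t C by (intro nn_integral_chain_transition) auto
    also have "\<dots> = (\<integral>\<^sup>+x. ennreal (indicator B x * measure (kernel t (coord (t - 1) x)) A) \<partial>chain n)"
    proof (intro nn_integral_cong)
      fix x assume x: "x \<in> space (chain n)"
      interpret K: prob_space "kernel t (coord (t - 1) x)" by (rule prob_space_kernel)
      have "(\<integral>\<^sup>+y. indicator A y \<partial>kernel t (coord (t - 1) x)) = emeasure (kernel t (coord (t - 1) x)) A"
        by (rule nn_integral_indicator) (simp add: kernel_def)
      then show "indicator C (restrict x {1..<t}) * (\<integral>\<^sup>+y. indicator A y \<partial>kernel t (coord (t - 1) x))
          = ennreal (indicator B x * measure (kernel t (coord (t - 1) x)) A)"
        using x by (simp add: iB K.emeasure_eq_measure ennreal_mult' flip: ennreal_indicator)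
    qed
    also have "enn2real \<dots> = (\<integral>x\<in>B. measure (kernel t (coord (t - 1) x)) A \<partial>chain n)"
      unfolding set_lebesgue_integral_def real_scaleR_def
      by (rule integral_eq_nn_integral[symmetric]) auto
    finally show "(\<integral>x\<in>B. indicator A (coord t x) \<partial>chain n)
      = (\<integral>x\<in>B. measure (kernel t (coord (t - 1) x)) A \<partial>chain n)" .
  next
    show "integrable (chain n) (\<lambda>x. indicator A (coord t x) :: real)"
      by (rule integrable_const_bound[of _ 1]) (auto simp: indicator_def)
    show "integrable (chain n) (\<lambda>x. measure (kernel t (coord (t - 1) x)) A)"
      by (rule integrable_const_bound[of _ 1]) (auto simp: le1)
  qed (rule mF)
qed

lemma has_cond_distr_past:
  assumes "t \<in> {1..n}"
  shows "has_cond_distr (chain n) (past_algebra (chain n) coord t) (coord t)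
    (\<lambda>x. kernel t (coord (t - 1) x))"
  using assms by (intro has_cond_distr_chain measurable_coord_past) (auto simp: subalgebra_def)

lemma has_cond_distr_present:
  assumes "t \<in> {1..n}"
  shows "has_cond_distr (chain n) (present_algebra (chain n) coord (t - 1)) (coord t)
    (\<lambda>x. kernel t (coord (t - 1) x))"
proof (intro has_cond_distr_chain subalgebra_present assms)
  show "coord (t - 1) \<in> borel_measurable (present_algebra (chain n) coord (t - 1))"
    unfolding present_algebra_def by (rule measurable_vimage_algebra1) auto
qed

text \<open>Both conditional probabilities are almost everywhere the same kernel value, hence agree
  with each other.\<close>

lemma markov_process_chain: "markov_process (chain n) coord n"
  unfolding markov_process_def
proof (intro conjI ballI)
  fix t assume "t \<in> {0..n}"
  then have "coord t \<in> borel_measurable (lborel_space n)"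
    by (intro measurable_coord_lborel_space) auto
  then show "coord t \<in> borel_measurable (chain n)"
    by (simp add: measurable_cong_sets[OF sets_chain refl])
next
  fix t and A :: "real set" assume t: "t \<in> {1..n}" and A: "A \<in> sets borel"
  have "AE x in chain n. real_cond_exp (chain n) (past_algebra (chain n) coord t)
      (\<lambda>x. indicator A (coord t x)) x = measure (kernel t (coord (t - 1) x)) A"
    and "AE x in chain n. real_cond_exp (chain n) (present_algebra (chain n) coord (t - 1))
      (\<lambda>x. indicator A (coord t x)) x = measure (kernel t (coord (t - 1) x)) A"
    using has_cond_distr_past[OF t] has_cond_distr_present[OF t] A
    unfolding has_cond_distr_def by blast+
  then show "AE x in chain n.
      real_cond_exp (chain n) (past_algebra (chain n) coord t) (\<lambda>x. indicator A (coord t x)) x =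
      real_cond_exp (chain n) (present_algebra (chain n) coord (t - 1)) (\<lambda>x. indicator A (coord t x)) x"
    by eventually_elim simp
qed (rule prob_space_chain)

end

lemma transition_densities_normal:
  assumes [measurable]: "\<And>t. m t \<in> borel_measurable borel" and s: "\<And>t. s t > 0"
  shows "transition_densities (\<lambda>t y z. ennreal (normal_density (m t y) (s t) z))"
proof
  show "(\<lambda>(y, z). ennreal (normal_density (m t y) (s t) z)) \<in> borel_measurable (borel \<Otimes>\<^sub>M borel)" for t
    unfolding normal_density_def by measurable
  show "(\<integral>\<^sup>+z. ennreal (normal_density (m t y) (s t) z) \<partial>lborel) = 1" for t y
    using prob_space.emeasure_space_1[OF prob_space_normal_density[OF s[of t], of "m t y"]]
    by (simp add: emeasure_density)
qed

subsection \<open>Random walks\<close>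

lemma transition_densities_random_walk:
  fixes f :: "real \<Rightarrow> ennreal"
  assumes [measurable]: "f \<in> borel_measurable borel" and f: "(\<integral>\<^sup>+x. f x \<partial>lborel) = 1"
  shows "transition_densities (\<lambda>_ y z. f (z - y))"
proof
  show "(\<lambda>(y, z). f (z - y)) \<in> borel_measurable (borel \<Otimes>\<^sub>M borel)"
    by measurable
  show "(\<integral>\<^sup>+z. f (z - y) \<partial>lborel) = 1" for y
    using nn_integral_real_affine[of "\<lambda>z. f (z - y)" 1 y] f by simp
qed

text \<open>Inverse of the map from a path to its increments; it turns the law of the increments
  back into the law of the path.\<close>

definition partial_sums :: "nat \<Rightarrow> (nat \<Rightarrow> real) \<Rightarrow> nat \<Rightarrow> real" where
  "partial_sums n z = (\<lambda>i\<in>{1..n}. \<Sum>j=1..i. z j)"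

lemma measurable_partial_sums:
  "partial_sums n \<in> (\<Pi>\<^sub>M i\<in>{1..n}. borel) \<rightarrow>\<^sub>M (\<Pi>\<^sub>M i\<in>{1..n}. borel)"
  unfolding partial_sums_def[abs_def]
  by (intro measurable_restrict borel_measurable_sum measurable_component_singleton) auto

text \<open>Using \<open>coord n\<close> in place of evaluation at \<open>n\<close> covers the case
  \<open>n = 0\<close>, where the path stands at its starting value 0.\<close>

lemma partial_sums_Suc:
  "partial_sums (Suc n) (z(Suc n := y))
    = (partial_sums n z)(Suc n := coord n (partial_sums n z) + y)"
proof
  have *: "(\<Sum>j=1..i. (z(Suc n := y)) j) = (\<Sum>j=1..i. z j)" if "i \<le> n" for i
    using that by (intro sum.cong) auto
  show "partial_sums (Suc n) (z(Suc n := y)) i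
      = ((partial_sums n z)(Suc n := coord n (partial_sums n z) + y)) i" for i
    using *[of i] *[of n]
    by (cases "i = Suc n"; cases "n = 0") (auto simp: partial_sums_def coord_def le_Suc_eq)
qed

text \<open>The sum telescopes, and the term left at its lower end is \<open>coord 0 x\<close>,
  which is 0.\<close>

lemma partial_sums_increments:
  assumes "x \<in> space (lborel_space n)"
  shows "partial_sums n (\<lambda>i\<in>{1..n}. coord i x - coord (i - 1) x) = x"
proof
  have *: "(\<Sum>j=1..i. coord j x - coord (j - 1) x) = coord i x" for i
    by (induction i) (auto simp: coord_def)
  fix i
  have "(\<Sum>j=1..i. (\<lambda>i\<in>{1..n}. coord i x - coord (i - 1) x) j) = coord i x" if "i \<le> n"
    using that by (intro trans[OF sum.cong *[of i]]) auto
  then show "partial_sums n (\<lambda>i\<in>{1..n}. coord i x - coord (i - 1) x) i = x i"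
    using assms by (cases "i \<in> {1..n}") (auto simp: partial_sums_def coord_def space_lborel_space)
qed

text \<open>Given the earlier increments, the new position is the old one shifted by a variable with
  density \<open>f\<close>, which is a transition with density \<open>f (z - y)\<close>. The only
  change of variables is a translation.\<close>

lemma nn_integral_partial_sums:
  fixes f :: "real \<Rightarrow> ennreal"
  assumes f [measurable]: "f \<in> borel_measurable borel" and f1: "(\<integral>\<^sup>+x. f x \<partial>lborel) = 1"
    and h: "h \<in> borel_measurable (lborel_space n)"
  shows "(\<integral>\<^sup>+z. h (partial_sums n z) \<partial>(\<Pi>\<^sub>M i\<in>{1..n}. density lborel f))
    = (\<integral>\<^sup>+x. h x \<partial>transition_densities.chain (\<lambda>_ y z. f (z - y)) n)"
  using h
proof (induction n arbitrary: h)
  interpret transition_densities "\<lambda>_ y z. f (z - y)"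
    by (rule transition_densities_random_walk[OF f f1])
  case 0
  have "space (lborel_space 0) = {\<lambda>_. undefined}" by (simp add: space_lborel_space)
  then have "(\<integral>\<^sup>+x. h x \<partial>chain 0) = (\<integral>\<^sup>+x. h (\<lambda>_. undefined) \<partial>chain 0)"
    by (intro nn_integral_cong) (simp add: space_chain)
  also have "\<dots> = h (\<lambda>_. undefined)"
    using prob_space.emeasure_space_1[OF prob_space_chain[of 0]] by simp
  finally show ?case
    by (simp add: PiM_empty nn_integral_count_space_finite partial_sums_def)
next
  interpret transition_densities "\<lambda>_ y z. f (z - y)"
    by (rule transition_densities_random_walk[OF f f1])
  case (Suc n)
  note [measurable] = Suc.prems
  define N where "N = density lborel f"
  interpret N: prob_space N
    by (rule prob_spaceI) (simp add: N_def emeasure_density f1)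
  interpret PN: product_sigma_finite "\<lambda>_::nat. N" by standard
  have sN: "sets N = sets borel" by (simp add: N_def)
  have PS: "partial_sums m \<in> (\<Pi>\<^sub>M i\<in>{1..m}. N) \<rightarrow>\<^sub>M lborel_space m" for m
    using measurable_partial_sums[of m]
    by (simp add: measurable_cong_sets[OF sets_PiM_cong[OF refl sN] sets_lborel_space])
  \<comment> \<open>This is \<open>h\<close> with its last coordinate integrated out along one
    transition. The induction hypothesis is applied to it, so \<open>h\<close> must vary in the
    induction.\<close>
  define H where "H = (\<lambda>x. \<integral>\<^sup>+y. f (y - coord n x) * h (x(Suc n := y)) \<partial>lborel)"
  note [measurable] = measurable_extend_lborel_space[of n] measurable_coord_lborel_space[of n n]
  have H: "H \<in> borel_measurable (lborel_space n)"
    unfolding H_def by measurable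
  have ins: "insert (Suc n) {1..n} = {1..Suc n}" by auto
  have "(\<integral>\<^sup>+z. h (partial_sums (Suc n) z) \<partial>(\<Pi>\<^sub>M i\<in>{1..Suc n}. N))
      = (\<integral>\<^sup>+z. (\<integral>\<^sup>+y. h (partial_sums (Suc n) (z(Suc n := y))) \<partial>N) \<partial>(\<Pi>\<^sub>M i\<in>{1..n}. N))"
    unfolding ins[symmetric]
    by (rule PN.product_nn_integral_insert) (auto simp: ins intro: measurable_compose[OF PS Suc.prems])
  also have "\<dots> = (\<integral>\<^sup>+z. H (partial_sums n z) \<partial>(\<Pi>\<^sub>M i\<in>{1..n}. N))"
  proof (intro nn_integral_cong)
    fix z assume "z \<in> space (\<Pi>\<^sub>M i\<in>{1..n}. N)"
    then have x: "partial_sums n z \<in> space (lborel_space n)"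
      by (rule measurable_space[OF PS])
    have up [measurable]: "(\<lambda>y. (partial_sums n z)(Suc n := y)) \<in> borel \<rightarrow>\<^sub>M lborel_space (Suc n)"
      using measurable_compose[OF measurable_Pair1'[OF x] measurable_extend_lborel_space] by simp
    define c where "c = coord n (partial_sums n z)"
    have "(\<integral>\<^sup>+y. h (partial_sums (Suc n) (z(Suc n := y))) \<partial>N)
        = (\<integral>\<^sup>+y. f y * h ((partial_sums n z)(Suc n := c + y)) \<partial>lborel)"
      unfolding N_def partial_sums_Suc c_def[symmetric]
      by (subst nn_integral_density) auto
    \<comment> \<open>The integration variable changes from the increment to the new position, a
      shift by \<open>c\<close>.\<close>
    also have "\<dots> = H (partial_sums n z)"
      using nn_integral_real_affine[of "\<lambda>y. f (y - c) * h ((partial_sums n z)(Suc n := y))" 1 c]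
      by (simp add: H_def c_def)
    finally show "(\<integral>\<^sup>+y. h (partial_sums (Suc n) (z(Suc n := y))) \<partial>N) = H (partial_sums n z)" .
  qed
  also have "\<dots> = (\<integral>\<^sup>+x. H x \<partial>chain n)"
    unfolding N_def by (rule Suc.IH[OF H])
  also have "\<dots> = (\<integral>\<^sup>+x. h x \<partial>chain (Suc n))"
    unfolding H_def by (rule nn_integral_chain_Suc[symmetric]) (rule Suc.prems)
  finally show ?case unfolding N_def .
qed

text \<open>The hypothesis concerns the measure with density \<open>p\<close>, which determines
  \<open>p\<close> only up to null sets; hence the almost everywhere conclusion.\<close>

lemma wiener_process_density:
  fixes p :: "(nat \<Rightarrow> real) \<Rightarrow> real"
  assumes "n \<ge> 1" "s > 0"
    and p: "p \<in> borel_measurable (lborel_space n)"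
    and W: "wiener_process (density (lborel_space n) (\<lambda>x. ennreal (p x))) coord n s"
  shows "AE x in lborel_space n.
    ennreal (p x) = (\<Prod>t=1..n. ennreal (normal_density (coord (t - 1) x) s (x t)))"
proof -
  define f where "f = (\<lambda>x. ennreal (normal_density 0 s x))"
  have f: "f \<in> borel_measurable borel" unfolding f_def by measurable
  have f1: "(\<integral>\<^sup>+x. f x \<partial>lborel) = 1"
    using prob_space.emeasure_space_1[OF prob_space_normal_density[OF \<open>s > 0\<close>, of 0]]
    by (simp add: emeasure_density f_def)
  interpret transition_densities "\<lambda>_ y z. f (z - y)"
    by (rule transition_densities_random_walk[OF f f1])
  define M where "M = density (lborel_space n) (\<lambda>x. ennreal (p x))"
  define D where "D = (\<lambda>x. \<lambda>i\<in>{1..n}. coord i x - coord (i - 1) x)"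
  interpret M: prob_space M using W by (simp add: wiener_process_def M_def)
  have d: "distributed M lborel (\<lambda>x. coord i x - coord (i - 1) x) f" if "i \<in> {1..n}" for i
    using W that by (simp add: wiener_process_def M_def f_def)
  have rv: "(\<lambda>x. coord i x - coord (i - 1) x) \<in> borel_measurable M" if "i \<in> {1..n}" for i
    using distributed_measurable[OF d[OF that]] by simp
  have sM: "sets M = sets (lborel_space n)" by (simp add: M_def)
  have spM: "space M = space (lborel_space n)" by (simp add: M_def)
  have D: "D \<in> M \<rightarrow>\<^sub>M (\<Pi>\<^sub>M i\<in>{1..n}. borel)"
    unfolding D_def by (intro measurable_restrict rv)
  have PS: "partial_sums n \<in> (\<Pi>\<^sub>M i\<in>{1..n}. borel) \<rightarrow>\<^sub>M lborel_space n"
    using measurable_partial_sums[of n]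
    by (simp add: measurable_cong_sets[OF refl sets_lborel_space])
  have "M.indep_vars (\<lambda>_. borel) (\<lambda>i x. coord i x - coord (i - 1) x) {1..n}"
    using W by (simp add: wiener_process_def M_def)
  \<comment> \<open>Independence says that the joint law of the increments is the product of their
    laws. The criterion asks for a nonempty index set, which \<open>n \<ge> 1\<close>
    provides.\<close>
  then have "distr M (\<Pi>\<^sub>M i\<in>{1..n}. borel) D
      = (\<Pi>\<^sub>M i\<in>{1..n}. distr M borel (\<lambda>x. coord i x - coord (i - 1) x))"
    unfolding D_def using \<open>n \<ge> 1\<close> rv by (subst (asm) M.indep_vars_iff_distr_eq_PiM') auto
  also have "\<dots> = (\<Pi>\<^sub>M i\<in>{1..n}. density lborel f)"
  proof (intro PiM_cong refl)
    fix i assume "i \<in> {1..n}"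
    have "distr M borel (\<lambda>x. coord i x - coord (i - 1) x)
        = distr M lborel (\<lambda>x. coord i x - coord (i - 1) x)"
      by (intro distr_cong) auto
    then show "distr M borel (\<lambda>x. coord i x - coord (i - 1) x) = density lborel f"
      using distributed_distr_eq_density[OF d[OF \<open>i \<in> {1..n}\<close>]] by simp
  qed
  finally have distr_D: "distr M (\<Pi>\<^sub>M i\<in>{1..n}. borel) D = (\<Pi>\<^sub>M i\<in>{1..n}. density lborel f)" .
  have "M = chain n"
  proof (rule measure_eqI)
    fix A assume "A \<in> sets M"
    then have A: "A \<in> sets (lborel_space n)" by (simp add: sM)
    have i: "indicator A \<in> borel_measurable (lborel_space n)" using A by simp
    have "emeasure M A = (\<integral>\<^sup>+x. indicator A x \<partial>M)"
      using A by (simp add: sM)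
    also have "\<dots> = (\<integral>\<^sup>+x. indicator A (partial_sums n (D x)) \<partial>M)"
      by (intro nn_integral_cong) (simp add: D_def partial_sums_increments spM)
    also have "\<dots> = (\<integral>\<^sup>+z. indicator A (partial_sums n z) \<partial>distr M (\<Pi>\<^sub>M i\<in>{1..n}. borel) D)"
      by (rule nn_integral_distr[symmetric, OF D]) (simp add: measurable_compose[OF PS i])
    also have "\<dots> = (\<integral>\<^sup>+x. indicator A x \<partial>chain n)"
      unfolding distr_D by (rule nn_integral_partial_sums[OF f f1 i])
    also have "\<dots> = emeasure (chain n) A"
      using A by (simp add: sets_chain)
    finally show "emeasure M A = emeasure (chain n) A" .
  qed (simp add: sM sets_chain)
  \<comment> \<open>Two densities of one measure with respect to a sigma-finite measure agree almost
    everywhere.\<close>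
  then have "AE x in lborel_space n. ennreal (p x) = chain_density n x"
    using sigma_finite_measure.density_unique_iff[OF sigma_finite_lborel_space, of "\<lambda>x. ennreal (p x)" n "chain_density n"] p
    by (simp add: M_def chain_def)
  then show ?thesis
    unfolding chain_density_def by (simp add: f_def normal_density_def)
qed

subsection \<open>Completing the square\<close>

text \<open>Here \<open>a\<close>, \<open>l\<close> and \<open>r\<close> are the precisions of the
  prior transition, of the observation and of the message from the future. The square in
  \<open>x\<close> yields the posterior transition; the square in \<open>y\<close> yields the
  message passed back, whose coefficient becomes \<open>\<rho> t * l\<theta>\<close>.\<close>

lemma complete_square:
  fixes a :: real
  assumes "a > 0" "l > 0" "r \<ge> 0"
  defines "P \<equiv> a + l + r"
  shows "l * (x - \<mu>)\<^sup>2 + r * (x - \<tau>')\<^sup>2 + a * (x - y)\<^sup>2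
    = P * (x - (a * y + l * \<mu> + r * \<tau>') / P)\<^sup>2
      + (l + r) / P * a * (y - (l * \<mu> + r * \<tau>') / (l + r))\<^sup>2 + l * r / (l + r) * (\<mu> - \<tau>')\<^sup>2"
proof -
  define u where "u = (l * \<mu> + r * \<tau>') / (l + r)"
  have "l + r > 0" "P > 0" using assms by auto
  then have u: "l * \<mu> + r * \<tau>' = (l + r) * u" and "l + r \<noteq> 0"
    by (simp_all add: u_def)
  \<comment> \<open>The two terms with fixed centres are merged first, around their weighted mean
    \<open>u\<close>; the transition term joins afterwards.\<close>
  have 1: "l * (x - \<mu>)\<^sup>2 + r * (x - \<tau>')\<^sup>2 = (l + r) * (x - u)\<^sup>2 + l * r / (l + r) * (\<mu> - \<tau>')\<^sup>2"
    unfolding u_def using \<open>l + r \<noteq> 0\<close> by (simp add: divide_simps) algebra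
  define m where "m = (a * y + (l + r) * u) / P"
  have m: "P * m = a * y + (l + r) * u" using \<open>P > 0\<close> by (simp add: m_def)
  have 2: "(l + r) * (x - u)\<^sup>2 + a * (x - y)\<^sup>2 = P * (x - m)\<^sup>2 + (l + r) / P * a * (y - u)\<^sup>2"
  proof -
    \<comment> \<open>Multiplying by \<open>P\<close> leaves a polynomial identity, in which
      \<open>P * m\<close> stands for the known combination of \<open>y\<close> and
      \<open>u\<close>.\<close>
    have "P * ((l + r) * (x - u)\<^sup>2 + a * (x - y)\<^sup>2) = (P * x - P * m)\<^sup>2 + (l + r) * a * (y - u)\<^sup>2"
      unfolding m by (simp only: P_def) algebra
    also have "\<dots> = P * (P * (x - m)\<^sup>2 + (l + r) / P * a * (y - u)\<^sup>2)"
      using \<open>P > 0\<close> by (simp add: field_simps power2_eq_square)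
    finally show ?thesis using \<open>P > 0\<close> by simp
  qed
  have "(a * y + l * \<mu> + r * \<tau>') / P = m"
    using u by (simp add: m_def add.assoc)
  then show ?thesis using 1 2 by (simp add: u_def)
qed

text \<open>Describing \<open>s\<close> by \<open>P * s\<^sup>2 = 1\<close> rather than as
  \<open>1 / sqrt P\<close> admits the form \<open>\<sigma>\<theta> * sqrt (1 - \<rho> t)\<close> in
  which the standard deviation appears later.\<close>

lemma normal_density_precision:
  assumes "s > 0" "P * s\<^sup>2 = 1"
  shows "normal_density m s x = sqrt (P / (2 * pi)) * exp (- (P * (x - m)\<^sup>2) / 2)"
proof -
  have "P \<noteq> 0" using assms(2) by auto
  then have s: "s\<^sup>2 = 1 / P" using assms(2) by (simp add: nonzero_eq_divide_eq mult.commute)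
  show ?thesis unfolding normal_density_def s
    using \<open>P \<noteq> 0\<close> by (simp add: real_sqrt_divide divide_simps mult_ac)
qed

text \<open>One step of the backward recursion: the factor \<open>exp (- r (x - \<tau>')\<^sup>2 / 2)\<close> is the message
  arriving at time \<open>t\<close> from the future, and the last factor on the right is the message passed on to
  time \<open>t - 1\<close>.\<close>

lemma normal_density_backward_step:
  fixes \<sigma>\<^sub>0 \<sigma> \<mu> r \<tau>' :: real
  assumes "\<sigma>\<^sub>0 > 0" "\<sigma> > 0" "r \<ge> 0"
  defines "a \<equiv> 1 / \<sigma>\<^sub>0\<^sup>2" and "l \<equiv> 1 / \<sigma>\<^sup>2"
  defines "P \<equiv> a + l + r"
  assumes s: "s > 0" "P * s\<^sup>2 = 1"
  obtains C where "C > 0"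
    "\<And>x y. normal_density y \<sigma>\<^sub>0 x * exp (- (1/2) * ((x - \<mu>) / \<sigma>)\<^sup>2) * exp (- (r * (x - \<tau>')\<^sup>2) / 2)
      = C * normal_density ((a * y + l * \<mu> + r * \<tau>') / P) s x
          * exp (- ((l + r) / P * a * (y - (l * \<mu> + r * \<tau>') / (l + r))\<^sup>2) / 2)"
proof
  \<comment> \<open>The quotient of the normalizing factors of the two normal densities, times the
    exponential of the remainder of the completed square, which depends on neither \<open>x\<close>
    nor \<open>y\<close>.\<close>
  define C where "C = sqrt (a / (2 * pi)) / sqrt (P / (2 * pi)) * exp (- (l * r / (l + r) * (\<mu> - \<tau>')\<^sup>2) / 2)"
  have pos: "a > 0" "l > 0" using assms by (auto simp: a_def l_def)
  then have P: "P > 0" using \<open>r \<ge> 0\<close> by (simp add: P_def)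
  show "C > 0" using pos P by (simp add: C_def)
  fix x y
  define m where "m = (a * y + l * \<mu> + r * \<tau>') / P"
  define E where "E = (l + r) / P * a * (y - (l * \<mu> + r * \<tau>') / (l + r))\<^sup>2"
  define D where "D = l * r / (l + r) * (\<mu> - \<tau>')\<^sup>2"
  have sq: "l * (x - \<mu>)\<^sup>2 + r * (x - \<tau>')\<^sup>2 + a * (x - y)\<^sup>2 = P * (x - m)\<^sup>2 + E + D"
    unfolding m_def E_def D_def P_def using complete_square[OF pos \<open>r \<ge> 0\<close>] .
  have "- (P * (x - m)\<^sup>2 + E + D) / 2 = - (P * (x - m)\<^sup>2) / 2 + - E / 2 + - D / 2"
    by (simp add: field_simps)
  then have e: "exp (- (l * (x - \<mu>)\<^sup>2 + r * (x - \<tau>')\<^sup>2 + a * (x - y)\<^sup>2) / 2)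
      = exp (- (P * (x - m)\<^sup>2) / 2) * exp (- E / 2) * exp (- D / 2)"
    by (simp only: sq exp_add)
  have "- (1/2) * ((x - \<mu>) / \<sigma>)\<^sup>2 = - (l * (x - \<mu>)\<^sup>2) / 2"
    by (simp add: l_def power_divide)
  moreover have "normal_density y \<sigma>\<^sub>0 x = sqrt (a / (2 * pi)) * exp (- (a * (x - y)\<^sup>2) / 2)"
    using assms by (intro normal_density_precision) (auto simp: a_def)
  ultimately have "normal_density y \<sigma>\<^sub>0 x * exp (- (1/2) * ((x - \<mu>) / \<sigma>)\<^sup>2) * exp (- (r * (x - \<tau>')\<^sup>2) / 2)
      = sqrt (a / (2 * pi)) * exp (- (l * (x - \<mu>)\<^sup>2 + r * (x - \<tau>')\<^sup>2 + a * (x - y)\<^sup>2) / 2)"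
    by (simp add: mult_exp_exp add_divide_distrib algebra_simps)
  also have "\<dots> = C * (sqrt (P / (2 * pi)) * exp (- (P * (x - m)\<^sup>2) / 2)) * exp (- E / 2)"
    unfolding e C_def D_def[symmetric] using P by simp
  finally show "normal_density y \<sigma>\<^sub>0 x * exp (- (1/2) * ((x - \<mu>) / \<sigma>)\<^sup>2) * exp (- (r * (x - \<tau>')\<^sup>2) / 2)
      = C * normal_density ((a * y + l * \<mu> + r * \<tau>') / P) s x
          * exp (- ((l + r) / P * a * (y - (l * \<mu> + r * \<tau>') / (l + r))\<^sup>2) / 2)"
    unfolding m_def[symmetric] E_def[symmetric] normal_density_precision[OF s] by simp
qed

text \<open>Applied with \<open>g\<close> the weighted prior transition, \<open>h\<close> the
  posterior transition times a constant and \<open>M\<close> the message. Each step trades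
  \<open>M (Suc n)\<close> for \<open>M n\<close>, so no division occurs.\<close>

lemma prod_telescope_factors:
  fixes g h M :: "nat \<Rightarrow> 'a::comm_semiring_1"
  assumes "\<And>t. t < n \<Longrightarrow> g (Suc t) * M (Suc t) = h (Suc t) * M t"
  shows "(\<Prod>t=1..n. g t) * M n = (\<Prod>t=1..n. h t) * M 0"
  using assms
proof (induction n)
  case (Suc n)
  have "(\<Prod>t=1..Suc n. g t) * M (Suc n) = (\<Prod>t=1..n. g t) * (g (Suc n) * M (Suc n))"
    by (simp add: mult_ac)
  also have "\<dots> = ((\<Prod>t=1..n. g t) * M n) * h (Suc n)"
    using Suc.prems[of n] by (simp add: mult_ac)
  also have "\<dots> = (\<Prod>t=1..Suc n. h t) * M 0"
    using Suc by (simp add: mult_ac)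
  finally show ?case .
qed simp

subsection \<open>The posterior of a Wiener process\<close>

theorem theorem1:
  fixes T :: nat
    and \<sigma>\<theta> l\<theta> :: real
    and p :: "(nat \<Rightarrow> real) \<Rightarrow> real"
    and \<mu> \<sigma> l \<rho> \<tau> :: "nat \<Rightarrow> real"
    and Q :: "(nat \<Rightarrow> real) measure"
  assumes T: "T \<ge> 1"
    and \<sigma>\<theta>: "\<sigma>\<theta> > 0"
    and p_measurable: "p \<in> borel_measurable (lborel_space T)"
    and p_nonneg: "\<And>x. x \<in> space (lborel_space T) \<Longrightarrow> p x \<ge> 0"
    and p_wiener: "wiener_process (density (lborel_space T) (\<lambda>x. ennreal (p x))) coord T \<sigma>\<theta>"
    and \<sigma>: "\<And>t. t \<in> {1..T} \<Longrightarrow> \<sigma> t > 0"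
    and Q: "Q = normalized_density (lborel_space T)
              (\<lambda>x. p x * (\<Prod>t=1..T. exp (- (1/2) * ((x t - \<mu> t) / \<sigma> t)\<^sup>2)))"
    and l\<theta>: "l\<theta> = 1 / \<sigma>\<theta>\<^sup>2"
    and l: "\<And>t. t \<in> {1..T} \<Longrightarrow> l t = 1 / (\<sigma> t)\<^sup>2"
    and \<rho>_end: "\<rho> (T + 1) = 0"
    and \<tau>_end: "\<tau> (T + 1) = 0"
    and \<rho>_rec: "\<And>t. t \<in> {1..T} \<Longrightarrow>
           \<rho> t = (l t + \<rho> (t + 1) * l\<theta>) / (l\<theta> + l t + \<rho> (t + 1) * l\<theta>)"
    and \<tau>_rec: "\<And>t. t \<in> {1..T} \<Longrightarrow>
           \<tau> t = (l t * \<mu> t + (\<rho> (t + 1) * l\<theta>) * \<tau> (t + 1)) / (l t + \<rho> (t + 1) * l\<theta>)"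
  shows "linear_gaussian_model Q coord T \<and>
    (\<forall>t\<in>{1..T}. has_cond_distr Q (past_algebra Q coord t) (coord t)
       (\<lambda>x. normal_measure
          ((l\<theta> * coord (t - 1) x + l t * \<mu> t + (\<rho> (t + 1) * l\<theta>) * \<tau> (t + 1))
             / (l\<theta> + l t + \<rho> (t + 1) * l\<theta>))
          (\<sigma>\<theta> * sqrt (1 - \<rho> t))))"
proof -
  \<comment> \<open>The precision of the message arriving at time \<open>t\<close> from the future;
    \<open>P t\<close> adds to it the precisions of the prior transition and of the
    observation.\<close>
  define r where "r t = \<rho> (t + 1) * l\<theta>" for t
  define P where "P t = l\<theta> + l t + r t" for t
  have l\<theta>_pos: "l\<theta> > 0" using \<sigma>\<theta> l\<theta> by simp
  have l_pos: "l t > 0" if "t \<in> {1..T}" for t using l[OF that] \<sigma>[OF that] by simp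
  have \<rho>_nonneg: "\<rho> t \<ge> 0" if "1 \<le> t" "t \<le> T + 1" for t
    using that(2,1)
  proof (induction t rule: inc_induct)
    case base
    then show ?case using \<rho>_end by simp
  next
    case (step t)
    then have "t \<in> {1..T}" "\<rho> (t + 1) \<ge> 0" by (simp_all add: Suc_eq_plus1)
    then show ?case using \<rho>_rec[of t] l\<theta>_pos l_pos[of t] by simp
  qed
  have r_nonneg: "r t \<ge> 0" if "t \<in> {1..T}" for t
    using that \<rho>_nonneg[of "t + 1"] l\<theta>_pos by (simp add: r_def)
  have P_pos: "P t > 0" if "t \<in> {1..T}" for t
    using l\<theta>_pos l_pos[OF that] r_nonneg[OF that] by (simp add: P_def)

  \<comment> \<open>Parameters of the posterior transitions\<close>
  define \<alpha> where "\<alpha> t = l\<theta> / P t" for t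
  define \<beta> where "\<beta> t = (l t * \<mu> t + r t * \<tau> (t + 1)) / P t" for t
  \<comment> \<open>The value 1 outside \<open>{1..T}\<close> makes every \<open>s t\<close>
    positive, as \<open>transition_densities_normal\<close> demands for all times.\<close>
  define s where "s t = (if t \<in> {1..T} then \<sigma>\<theta> * sqrt (1 - \<rho> t) else 1)" for t
  \<comment> \<open>Hence \<open>(s t)\<^sup>2\<close> is
    \<open>\<sigma>\<theta>\<^sup>2 * l\<theta> / P t = 1 / P t\<close> on \<open>{1..T}\<close>:
    the claimed standard deviation matches the precision found by completing the square.\<close>
  have one_minus_\<rho>: "1 - \<rho> t = l\<theta> / P t" if "t \<in> {1..T}" for t
    using \<rho>_rec[OF that] P_pos[OF that] by (simp add: r_def P_def field_simps)
  have s_pos: "s t > 0" for t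
    using \<sigma>\<theta> l\<theta>_pos P_pos by (simp add: s_def one_minus_\<rho>)
  have s_prec: "P t * (s t)\<^sup>2 = 1" if "t \<in> {1..T}" for t
    using that \<sigma>\<theta> l\<theta> l\<theta>_pos P_pos[OF that]
    by (simp add: s_def one_minus_\<rho> power_mult_distrib)

  interpret transition_densities "\<lambda>t y z. ennreal (normal_density (\<alpha> t * y + \<beta> t) (s t) z)"
    by (rule transition_densities_normal) (use s_pos in auto)
  have kernel: "kernel t y = normal_measure (\<alpha> t * y + \<beta> t) (s t)" for t y
    by (simp add: kernel_def normal_measure_def)

  \<comment> \<open>Backward messages\<close>
  define e where "e t z = exp (- (1/2) * ((z - \<mu> t) / \<sigma> t)\<^sup>2)" for t z
  \<comment> \<open>A message is indexed by the time at which it arrives, hence \<open>t + 1\<close>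
    on the right. At time \<open>T\<close> it is 1 since \<open>\<rho> (T + 1) = 0\<close>; at time
    0 it will be evaluated at the starting value 0 and is then a constant.\<close>
  define M where "M t y = exp (- (\<rho> (t + 1) * l\<theta> * (y - \<tau> (t + 1))\<^sup>2) / 2)" for t y
  have "\<exists>C>0. \<forall>x y. normal_density y \<sigma>\<theta> x * e t x * M t x
      = C * normal_density (\<alpha> t * y + \<beta> t) (s t) x * M (t - 1) y" if t: "t \<in> {1..T}" for t
  proof -
    obtain C where C: "C > 0"
      "\<And>x y. normal_density y \<sigma>\<theta> x * exp (- (1/2) * ((x - \<mu> t) / \<sigma> t)\<^sup>2)
          * exp (- (r t * (x - \<tau> (t + 1))\<^sup>2) / 2)
        = C * normal_density ((l\<theta> * y + l t * \<mu> t + r t * \<tau> (t + 1)) / P t) (s t) x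
          * exp (- ((l t + r t) / P t * l\<theta> * (y - (l t * \<mu> t + r t * \<tau> (t + 1)) / (l t + r t))\<^sup>2) / 2)"
      using normal_density_backward_step[OF \<sigma>\<theta> \<sigma>[OF t] r_nonneg[OF t] s_pos[of t],
          of "\<mu> t" "\<tau> (t + 1)"] s_prec[OF t]
      unfolding l\<theta>[symmetric] l[OF t, symmetric] P_def[symmetric] by blast
    have "(l\<theta> * y + l t * \<mu> t + r t * \<tau> (t + 1)) / P t = \<alpha> t * y + \<beta> t" for y
      by (simp add: \<alpha>_def \<beta>_def add_divide_distrib)
    \<comment> \<open>Subtraction is exact for \<open>t \<ge> 1\<close>, so \<open>M (t - 1)\<close>
      involves \<open>\<rho> t\<close> and \<open>\<tau> t\<close>, the values that the recursion
      produces.\<close>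
    moreover have "t - 1 + 1 = t" using t by simp
    moreover have "\<rho> t = (l t + r t) / P t" "\<tau> t = (l t * \<mu> t + r t * \<tau> (t + 1)) / (l t + r t)"
      using \<rho>_rec[OF t] \<tau>_rec[OF t] by (simp_all add: r_def P_def)
    ultimately show ?thesis
      using C by (intro exI[of _ C]) (simp add: e_def M_def r_def)
  qed
  then obtain C where C_pos: "\<And>t. t \<in> {1..T} \<Longrightarrow> C t > 0"
    and C: "\<And>t x y. t \<in> {1..T} \<Longrightarrow> normal_density y \<sigma>\<theta> x * e t x * M t x
      = C t * normal_density (\<alpha> t * y + \<beta> t) (s t) x * M (t - 1) y"
    by metis

  define g where "g x = (\<Prod>t=1..T. normal_density (\<alpha> t * coord (t - 1) x + \<beta> t) (s t) (x t))" for x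
  \<comment> \<open>The constants of all steps times the message that telescoping leaves at the
    start; it turns out to be the integral of \<open>f\<close>.\<close>
  define K where "K = (\<Prod>t=1..T. C t) * M 0 0"
  have K_pos: "K > 0"
    unfolding K_def by (intro mult_pos_pos prod_pos) (auto simp: C_pos M_def)
  have g_nonneg: "g x \<ge> 0" for x
    unfolding g_def by (intro prod_nonneg) auto
  have g_chain: "ennreal (g x) = chain_density T x" for x
    unfolding g_def chain_density_def by (subst prod_ennreal) auto
  have g_measurable: "g \<in> borel_measurable (lborel_space T)"
  proof -
    have "(\<lambda>x. enn2real (chain_density T x)) \<in> borel_measurable (lborel_space T)" by measurable
    then show ?thesis by (simp add: g_nonneg flip: g_chain)
  qed
  have M_end: "M T y = 1" for y using \<rho>_end by (simp add: M_def)
  have factorization: "(\<Prod>t=1..T. normal_density (coord (t - 1) x) \<sigma>\<theta> (x t)) * (\<Prod>t=1..T. e t (x t))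
      = K * g x" for x
  proof -
    have "(\<Prod>t=1..T. normal_density (coord (t - 1) x) \<sigma>\<theta> (x t) * e t (x t)) * M T (coord T x)
      = (\<Prod>t=1..T. C t * normal_density (\<alpha> t * coord (t - 1) x + \<beta> t) (s t) (x t)) * M 0 (coord 0 x)"
    proof (rule prod_telescope_factors)
      fix t assume "t < T"
      then show "normal_density (coord (Suc t - 1) x) \<sigma>\<theta> (x (Suc t)) * e (Suc t) (x (Suc t)) * M (Suc t) (coord (Suc t) x)
        = C (Suc t) * normal_density (\<alpha> (Suc t) * coord (Suc t - 1) x + \<beta> (Suc t)) (s (Suc t)) (x (Suc t)) * M t (coord t x)"
        using C[of "Suc t" "coord t x" "x (Suc t)"] by (simp add: coord_def[of "Suc t"])
    qed
    then show ?thesis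
      by (simp add: M_end prod.distrib K_def g_def coord_def[of 0] mult_ac)
  qed

  \<comment> \<open>The law \<open>Q\<close> as a chain\<close>
  define f where "f = (\<lambda>x. p x * (\<Prod>t=1..T. exp (- (1/2) * ((x t - \<mu> t) / \<sigma> t)\<^sup>2)))"
  have f_eq: "f x = p x * (\<Prod>t=1..T. e t (x t))" for x
    by (simp add: f_def e_def)
  have e_measurable: "(\<lambda>x. \<Prod>t=1..T. e t (x t)) \<in> borel_measurable (lborel_space T)"
  proof (intro borel_measurable_prod)
    fix t assume "t \<in> {1..T}"
    note [measurable] = measurable_component_singleton_lborel_space[OF this]
    show "(\<lambda>x. e t (x t)) \<in> borel_measurable (lborel_space T)"
      unfolding e_def by measurable
  qed
  have f_measurable: "f \<in> borel_measurable (lborel_space T)"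
    unfolding f_eq[abs_def] by (intro borel_measurable_times p_measurable e_measurable)
  have f_AE: "AE x in lborel_space T. f x = K * g x"
    using wiener_process_density[OF T \<sigma>\<theta> p_measurable p_wiener] AE_space
  proof eventually_elim
    case (elim x)
    have "ennreal (p x) = ennreal (\<Prod>t=1..T. normal_density (coord (t - 1) x) \<sigma>\<theta> (x t))"
      using elim by (simp add: prod_ennreal)
    \<comment> \<open>Nonnegativity of \<open>p\<close> permits passing from equality in
      \<open>ennreal\<close> to equality of real numbers.\<close>
    then have "p x = (\<Prod>t=1..T. normal_density (coord (t - 1) x) \<sigma>\<theta> (x t))"
      using p_nonneg[OF elim(2)] by (subst (asm) ennreal_inj) (auto intro!: prod_nonneg)
    then show ?case using factorization[of x] by (simp add: f_eq)
  qed
  \<comment> \<open>A chain has mass 1 and \<open>g\<close> is its density, so the normalizing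
    constant of \<open>f\<close> comes out as \<open>K\<close> without computing any multivariate
    Gaussian integral.\<close>
  have "(\<integral>x. g x \<partial>lborel_space T) = enn2real (\<integral>\<^sup>+x. ennreal (g x) \<partial>lborel_space T)"
    by (rule integral_eq_nn_integral) (auto simp: g_nonneg g_measurable)
  also have "(\<integral>\<^sup>+x. ennreal (g x) \<partial>lborel_space T) = emeasure (chain T) (space (chain T))"
    by (simp add: g_chain chain_def emeasure_density cong: nn_integral_cong)
  also have "\<dots> = 1" by (rule prob_space.emeasure_space_1[OF prob_space_chain])
  finally have g_int: "(\<integral>x. g x \<partial>lborel_space T) = 1" by simp
  have "(\<integral>x. f x \<partial>lborel_space T) = (\<integral>x. K * g x \<partial>lborel_space T)"
    by (rule integral_cong_AE) (use f_AE f_measurable g_measurable in auto)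
  then have f_int: "(\<integral>x. f x \<partial>lborel_space T) = K"
    by (simp add: g_int)
  have "Q = density (lborel_space T) (\<lambda>x. ennreal (f x / K))"
    unfolding Q normalized_density_def f_def[symmetric] f_int[symmetric] by (simp add: f_def)
  also have "\<dots> = chain T"
    unfolding chain_def
  proof (rule density_cong)
    show "AE x in lborel_space T. ennreal (f x / K) = chain_density T x"
      using f_AE by eventually_elim (use K_pos in \<open>simp add: g_chain\<close>)
  qed (use f_measurable in measurable)
  finally have Q_chain: "Q = chain T" .

  have "linear_gaussian_model (chain T) coord T"
    unfolding linear_gaussian_model_def
  proof (intro conjI ballI)
    have "\<forall>t\<in>{1..T}. s t > 0 \<and> has_cond_distr (chain T) (present_algebra (chain T) coord (t - 1)) (coord t)
        (\<lambda>x. normal_measure (\<alpha> t * coord (t - 1) x + \<beta> t) (s t))"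
      using s_pos has_cond_distr_present[unfolded kernel] by blast
    then show "\<exists>\<alpha> \<beta> s. \<forall>t\<in>{1..T}. s t > 0 \<and>
        has_cond_distr (chain T) (present_algebra (chain T) coord (t - 1)) (coord t)
          (\<lambda>x. normal_measure (\<alpha> t * coord (t - 1) x + \<beta> t) (s t))"
      by blast
  qed (auto simp: markov_process_chain coord_def[of 0])
  moreover have "has_cond_distr (chain T) (past_algebra (chain T) coord t) (coord t)
       (\<lambda>x. normal_measure
          ((l\<theta> * coord (t - 1) x + l t * \<mu> t + (\<rho> (t + 1) * l\<theta>) * \<tau> (t + 1))
             / (l\<theta> + l t + \<rho> (t + 1) * l\<theta>))
          (\<sigma>\<theta> * sqrt (1 - \<rho> t)))" if t: "t \<in> {1..T}" for t
  proof -
    have "(l\<theta> * y + l t * \<mu> t + (\<rho> (t + 1) * l\<theta>) * \<tau> (t + 1)) / (l\<theta> + l t + \<rho> (t + 1) * l\<theta>)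
        = \<alpha> t * y + \<beta> t" for y
      by (simp add: \<alpha>_def \<beta>_def P_def r_def add_divide_distrib)
    moreover have "\<sigma>\<theta> * sqrt (1 - \<rho> t) = s t" using t by (simp add: s_def)
    ultimately show ?thesis using has_cond_distr_past[OF t] by (simp only: kernel)
  qed
  ultimately show ?thesis by (simp add: Q_chain)
qed

end
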